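(* The homeomorphism $\zeta:Z\to Z$ constructed from $(S^d,\varphi)$ (see context) is minimal, i.e. the only closed $\zeta$-invariant subsets of $Z$ are $\emptyset$ and $Z$.
   Context: Construction of $(Z,\zeta)$. Let $d>1$ be an odd integer and $\varphi:S^d\to S^d$ a minimal diffeomorphism (every $\varphi$-orbit is dense). Write $B^{d-1}(r)$ for the open ball of radius $r$ centred at $0$ in $\mathbb{R}^{d-1}$ and $|\cdot|$ for the Euclidean norm. Fix $\epsilon>0$ and a continuous injection $\tau_0:[-\epsilon,1+\epsilon]\times\overline{B^{d-1}(1)}\to S^d$ such that (a) $\tau_0(s+1,x)=\varphi(\tau_0(s,x))$ for $|s|\le\epsilon$ and $x\in\overline{B^{d-1}(1)}$; (b) $\varphi^n(\tau_0([0,1)\times\{0\}))\cap\tau_0([0,1)\times\{0\})=\emptyset$ for all $n\ne0$ (such data exist). Define $\tau:\mathbb{R}\times\overline{B^{d-1}(1)}\to S^d$ by $\tau(s,x)=\varphi^{\lfloor s\rfloor}(\tau_0(s \bmod 1,x))$, where $s\bmod 1\in[0,1)$. Fix numbers $1>\rho_1>\rho_2>\cdots>0$ such that for each $n\ge1$ the restriction of $\tau$ to $[-n-2,n+2]\times\overline{B^{d-1}(2\rho_n)}$ is (defined and) injective (such numbers exist). Define $r_n:\mathbb{R}\to[0,1]$ by $r_n(s)=0$ if $|s|>n$, $r_n(s)=n-|s|$ if $n-\rho_n\le|s|\le n$, and $r_n(s)=\rho_n$ if $|s|\le n-\rho_n$. Put $L_n=\tau([-n,n]\times\{0\})$, $L_\infty=\tau(\mathbb{R}\times\{0\})$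 and $R_n=\tau(\{(s,x)\mid -n\le s\le n,\ x\in\mathbb{R}^{d-1},\ 0<|x|\le 2r_n(s)\})$. Every point of $R_n$ is uniquely of the form $\tau(s,tx)$ with $-n\le s\le n$, $0<t\le2r_n(s)$, $x\in S^{d-2}$; define $\beta_n:S^d\setminus L_n\to S^d$ by $\beta_n(\tau(s,tx))=\tau(s,(\tfrac t2+r_n(s))x)$ on $R_n$ and $\beta_n=\mathrm{id}$ on $S^d\setminus(L_n\cup R_n)$. Fix a metric $d_0$ on $S^d$ inducing the usual topology, and define metrics $d_n(x,y)=d_0(\beta_n(x),\beta_n(y))$ on $S^d\setminus L_n$ ($n\ge1$) and $d_\infty(x,y)=\sum_{n\ge1}2^{-n}d_n(x,y)$ on $S^d\setminus L_\infty$. The space $Z$ is the completion of $S^d\setminus L_\infty$ in the metric $d_\infty$; it is compact. The set $L_\infty$ is $\varphi$-invariant, and the restriction of $\varphi$ to $S^d\setminus L_\infty$ extends to a homeomorphism $\zeta$ of $(Z,d_\infty)$. *)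

theory Defs
  imports "HOL-Analysis.Analysis"
begin

section \<open>Smooth maps and diffeomorphisms of subsets of Euclidean space\<close>

text \<open>On an open set \<open>U\<close> this is the usual class \<open>C\<^sup>k\<close>: all iterated directional derivatives up to
  order \<open>k\<close> exist, as total derivatives, and are continuous.\<close>

primrec Ck_on :: "nat \<Rightarrow> ('a::euclidean_space \<Rightarrow> 'b::euclidean_space) \<Rightarrow> 'a set \<Rightarrow> bool" where
  "Ck_on 0 f U \<longleftrightarrow> continuous_on U f"
| "Ck_on (Suc k) f U \<longleftrightarrow>
     (\<forall>x\<in>U. f differentiable (at x)) \<and> (\<forall>v. Ck_on k (\<lambda>x. frechet_derivative f (at x) v) U)"

text \<open>A map on a submanifold \<open>S\<close> of Euclidean space is smooth iff near every point of \<open>S\<close> it is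
  the restriction of a \<open>C\<^sup>\<infinity>\<close> map defined on an open subset of the ambient space.\<close>

definition smooth_map_on ::
  "('a::euclidean_space \<Rightarrow> 'b::euclidean_space) \<Rightarrow> 'a set \<Rightarrow> bool" where
  "smooth_map_on f S \<longleftrightarrow>
     (\<forall>x\<in>S. \<exists>U g. open U \<and> x \<in> U \<and> (\<forall>k. Ck_on k g U) \<and> (\<forall>y\<in>U \<inter> S. g y = f y))"

definition diffeomorphism_of :: "'a::euclidean_space set \<Rightarrow> ('a \<Rightarrow> 'a) \<Rightarrow> bool" where
  "diffeomorphism_of S f \<longleftrightarrow>
     bij_betw f S S \<and> smooth_map_on f S \<and> smooth_map_on (inv_into S f) S"


section \<open>Dynamics\<close>

definition iter :: "'a set \<Rightarrow> ('a \<Rightarrow> 'a) \<Rightarrow> int \<Rightarrow> 'a \<Rightarrow> 'a" where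
  "iter S f k = (if 0 \<le> k then f ^^ nat k else inv_into S f ^^ nat (- k))"

definition all_orbits_dense :: "'a::topological_space set \<Rightarrow> ('a \<Rightarrow> 'a) \<Rightarrow> bool" where
  "all_orbits_dense S f \<longleftrightarrow> (\<forall>x\<in>S. S \<subseteq> closure (range (\<lambda>k. iter S f k x)))"

text \<open>Invariance of \<open>C\<close> is taken as \<open>f ` C \<subseteq> C\<close>; for homeomorphisms of compact spaces this gives the
  same notion of minimality as \<open>f ` C = C\<close>, and in general a formally stronger one.\<close>

definition minimal_map :: "'a topology \<Rightarrow> ('a \<Rightarrow> 'a) \<Rightarrow> bool" where
  "minimal_map X f \<longleftrightarrow>
     (\<forall>C. closedin X C \<and> f ` C \<subseteq> C \<longrightarrow> C = {} \<or> C = topspace X)"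


section \<open>Completions\<close>

text \<open>\<open>d\<close> is only looked at on \<open>M\<close>; \<open>\<iota>\<close> is the canonical isometric embedding.\<close>

definition is_completion ::
  "'a set \<Rightarrow> ('a \<Rightarrow> 'a \<Rightarrow> real) \<Rightarrow> 'z metric \<Rightarrow> ('a \<Rightarrow> 'z) \<Rightarrow> bool" where
  "is_completion M d Z \<iota> \<longleftrightarrow>
     \<iota> ` M \<subseteq> mspace Z \<and>
     (\<forall>x\<in>M. \<forall>y\<in>M. mdist Z (\<iota> x) (\<iota> y) = d x y) \<and>
     mcomplete_of Z \<and>
     mtopology_of Z closure_of (\<iota> ` M) = mspace Z"


section \<open>The construction\<close>

text \<open>The sphere \<open>S\<^sup>d\<close> is the unit sphere of \<open>real ^ 'm\<close> and \<open>\<real>\<^sup>d\<^sup>-\<^sup>1\<close> is \<open>real ^ 'n\<close>; the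
  cardinalities of the index types are fixed where the definitions are used. Values of \<open>\<phi>\<close> off the
  sphere and of \<open>\<tau>\<^sub>0\<close> off \<open>[-\<epsilon>, 1+\<epsilon>] \<times> cball 0 1\<close> are irrelevant.\<close>

definition tau ::
  "(real^'m \<Rightarrow> real^'m) \<Rightarrow> (real \<times> (real^'n) \<Rightarrow> real^'m) \<Rightarrow> real \<times> (real^'n) \<Rightarrow> real^'m" where
  "tau \<phi> \<tau>\<^sub>0 = (\<lambda>(s, x). iter (sphere 0 1) \<phi> \<lfloor>s\<rfloor> (\<tau>\<^sub>0 (frac s, x)))"

definition rad :: "(nat \<Rightarrow> real) \<Rightarrow> nat \<Rightarrow> real \<Rightarrow> real" where
  "rad \<rho> n s =
     (if \<bar>s\<bar> > real n then 0
      else if real n - \<rho> n \<le> \<bar>s\<bar> then real n - \<bar>s\<bar>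
      else \<rho> n)"

definition L_fin ::
  "(real^'m \<Rightarrow> real^'m) \<Rightarrow> (real \<times> (real^'n) \<Rightarrow> real^'m) \<Rightarrow> nat \<Rightarrow> (real^'m) set" where
  "L_fin \<phi> \<tau>\<^sub>0 n = tau \<phi> \<tau>\<^sub>0 ` ({- real n..real n} \<times> {0})"

definition L_inf ::
  "(real^'m \<Rightarrow> real^'m) \<Rightarrow> (real \<times> (real^'n) \<Rightarrow> real^'m) \<Rightarrow> (real^'m) set" where
  "L_inf \<phi> \<tau>\<^sub>0 = tau \<phi> \<tau>\<^sub>0 ` (UNIV \<times> {0})"

definition R_set ::
  "(real^'m \<Rightarrow> real^'m) \<Rightarrow> (real \<times> (real^'n) \<Rightarrow> real^'m) \<Rightarrow> (nat \<Rightarrow> real) \<Rightarrow> nat \<Rightarrow> (real^'m) set" where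
  "R_set \<phi> \<tau>\<^sub>0 \<rho> n =
     tau \<phi> \<tau>\<^sub>0 ` {(s, x). - real n \<le> s \<and> s \<le> real n \<and> 0 < norm x \<and> norm x \<le> 2 * rad \<rho> n s}"

text \<open>Only the values of \<open>\<beta>\<^sub>n\<close> on the complement of \<open>L\<^sub>n\<close> in the sphere matter.\<close>

definition beta ::
  "(real^'m \<Rightarrow> real^'m) \<Rightarrow> (real \<times> (real^'n) \<Rightarrow> real^'m) \<Rightarrow> (nat \<Rightarrow> real) \<Rightarrow> nat
     \<Rightarrow> real^'m \<Rightarrow> real^'m" where
  "beta \<phi> \<tau>\<^sub>0 \<rho> n y =
     (if y \<in> R_set \<phi> \<tau>\<^sub>0 \<rho> n then
        (THE z. \<exists>s t x. - real n \<le> s \<and> s \<le> real n \<and> 0 < t \<and> t \<le> 2 * rad \<rho> n s \<and> norm x = 1 \<and>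
           y = tau \<phi> \<tau>\<^sub>0 (s, t *\<^sub>R x) \<and> z = tau \<phi> \<tau>\<^sub>0 (s, (t / 2 + rad \<rho> n s) *\<^sub>R x))
      else y)"

definition dist_fin ::
  "(real^'m \<Rightarrow> real^'m) \<Rightarrow> (real \<times> (real^'n) \<Rightarrow> real^'m) \<Rightarrow> (nat \<Rightarrow> real) \<Rightarrow> (real^'m) metric \<Rightarrow> nat
     \<Rightarrow> real^'m \<Rightarrow> real^'m \<Rightarrow> real" where
  "dist_fin \<phi> \<tau>\<^sub>0 \<rho> d\<^sub>0 n x y = mdist d\<^sub>0 (beta \<phi> \<tau>\<^sub>0 \<rho> n x) (beta \<phi> \<tau>\<^sub>0 \<rho> n y)"

text \<open>The series over \<open>n \<ge> 1\<close> is reindexed by \<open>Suc\<close>.\<close>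

definition dist_inf ::
  "(real^'m \<Rightarrow> real^'m) \<Rightarrow> (real \<times> (real^'n) \<Rightarrow> real^'m) \<Rightarrow> (nat \<Rightarrow> real) \<Rightarrow> (real^'m) metric
     \<Rightarrow> real^'m \<Rightarrow> real^'m \<Rightarrow> real" where
  "dist_inf \<phi> \<tau>\<^sub>0 \<rho> d\<^sub>0 x y = (\<Sum>n. (1 / 2) ^ Suc n * dist_fin \<phi> \<tau>\<^sub>0 \<rho> d\<^sub>0 (Suc n) x y)"

end

theory Submission
  imports Defs
begin

text \<open>
  Let \<open>M\<close> be the sphere minus \<open>L\<^sub>\<infinity>\<close>, with the topology inherited from the sphere. The theorem rests
  on two facts: the embedding \<open>\<iota>\<close> of \<open>M\<close> into the completion \<open>Z\<close> is continuous, and every forward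
  \<open>\<phi>\<close>-orbit in the sphere comes close to every point of \<open>M\<close>.

  Given these, let \<open>z\<close> lie in a closed set \<open>C\<close> with \<open>\<zeta> ` C \<subseteq> C\<close>, and let \<open>y \<in> M\<close>. Choose \<open>x\<^sub>k \<in> M\<close> with
  \<open>\<iota> x\<^sub>k \<longlonglongrightarrow> z\<close>; as the sphere is compact, we may assume that \<open>x\<^sub>k \<longlonglongrightarrow> x\<close> in the sphere. Some
  \<open>\<phi>\<^sup>n x\<close> is close to \<open>y\<close>, hence so is \<open>\<phi>\<^sup>n x\<^sub>k\<close> for large \<open>k\<close>, and by continuity of \<open>\<iota>\<close> at \<open>y\<close> the point
  \<open>\<iota> (\<phi>\<^sup>n x\<^sub>k) = \<zeta>\<^sup>n (\<iota> x\<^sub>k)\<close> is close to \<open>\<iota> y\<close>. But \<open>\<zeta>\<^sup>n (\<iota> x\<^sub>k)\<close> tends to \<open>\<zeta>\<^sup>n z \<in> C\<close>, so points of \<open>C\<close> come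
  arbitrarily close to \<open>\<iota> y\<close>, and \<open>\<iota> y \<in> C\<close>. Thus \<open>C\<close> contains the dense set \<open>\<iota> ` M\<close> and is all of
  \<open>Z\<close>. This is \<open>minimal_map_if_continuous_dense_embedding\<close>.

  Continuity of \<open>\<iota>\<close> means that \<open>d\<^sub>\<infinity>\<close> is continuous for the topology of the sphere. The series for
  \<open>d\<^sub>\<infinity>\<close> converges uniformly, so it is enough that each \<open>\<beta>\<^sub>n\<close> is continuous off the arc \<open>L\<^sub>n\<close>
  (\<open>continuous_on_beta\<close>). On the tube around \<open>L\<^sub>n\<close> the map \<open>\<beta>\<^sub>n\<close> is an explicit radial push in the
  coordinates of \<open>\<tau>\<close>, and it is the identity where \<open>\<bar>x\<bar> = 2 r\<^sub>n(s)\<close>. These points contain the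
  boundary of the tube in the sphere, because \<open>\<tau>\<close> maps \<open>{\<bar>x\<bar> < 2 r\<^sub>n(s)}\<close> onto an open set; so the
  push and the identity fit together continuously. The openness is invariance of domain, and
  this is where the dimension \<open>d - 1\<close> of the cross-section enters.
\<close>

section \<open>Iterates and dense orbits\<close>

lemma diffeomorphism_of_imp_homeo:
  assumes "diffeomorphism_of S f"
  shows "bij_betw f S S" "continuous_on S f" "continuous_on S (inv_into S f)"
proof -
  have "continuous_on S g" if g: "smooth_map_on g S" for g :: "'a \<Rightarrow> 'a"
  proof (clarsimp simp: continuous_on_eq_continuous_within)
    fix x assume "x \<in> S"
    then obtain U k where "open U" "x \<in> U" "\<forall>i. Ck_on i k U" and eq: "\<forall>y\<in>U \<inter> S. k y = g y"
      using g by (auto simp: smooth_map_on_def)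
    then have "continuous_on U k" "open U"
      using Ck_on.simps(1) by blast+
    then have "isCont k x"
      using \<open>x \<in> U\<close> by (simp add: continuous_on_eq_continuous_at)
    then have "continuous (at x within S) k"
      by (simp add: continuous_at_imp_continuous_at_within)
    moreover have "\<forall>\<^sub>F y in at x within S. k y = g y"
      using \<open>open U\<close> \<open>x \<in> U\<close> eq unfolding eventually_at_topological by blast
    ultimately show "continuous (at x within S) g"
      using \<open>x \<in> U\<close> \<open>x \<in> S\<close> eq by (simp add: continuous_within tendsto_cong)
  qed
  then show "bij_betw f S S" "continuous_on S f" "continuous_on S (inv_into S f)"
    using assms by (auto simp: diffeomorphism_of_def)
qed

lemma iter_in:
  assumes "bij_betw f S S" "x \<in> S"
  shows "iter S f k x \<in> S"
proof -
  have "(f ^^ n) x \<in> S \<and> (inv_into S f ^^ n) x \<in> S" for n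
    using assms by (induction n) (auto simp: bij_betw_def inv_into_into)
  then show ?thesis by (simp add: iter_def)
qed

lemma continuous_on_iter:
  assumes "bij_betw f S S" "continuous_on S f" "continuous_on S (inv_into S f)"
  shows "continuous_on S (iter S f k)"
proof -
  have pow: "continuous_on S (g ^^ n)" if "g ` S \<subseteq> S" "continuous_on S g" for g :: "'a \<Rightarrow> 'a" and n
  proof (induction n)
    case (Suc n)
    have "(g ^^ n) ` S \<subseteq> S"
      using that(1) by (induction n) auto
    then show ?case
      using Suc continuous_on_compose2[OF that(2), of S "g ^^ n"] by (simp add: o_def)
  qed (simp add: id_def)
  have "inv_into S f ` S \<subseteq> S"
    using assms(1) by (auto simp: bij_betw_def inv_into_into)
  then show ?thesis
    using assms pow by (auto simp: iter_def bij_betw_def)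
qed

lemma iter_after_funpow:
  assumes "bij_betw f S S" "x \<in> S" "0 \<le> int m + j"
  shows "iter S f j ((f ^^ m) x) = (f ^^ nat (int m + j)) x"
proof (cases "0 \<le> j")
  case True
  then have "nat (int m + j) = nat j + m" by simp
  then show ?thesis
    using True by (simp add: iter_def funpow_add)
next
  case False
  have *: "(inv_into S f ^^ i) ((f ^^ m) x) = (f ^^ (m - i)) x" if "i \<le> m" for i
    using that
  proof (induction i)
    case (Suc i)
    define l where "l = m - Suc i"
    have "m - i = Suc l"
      using Suc.prems by (simp add: l_def)
    moreover have "(f ^^ l) x \<in> S"
      using iter_in[OF assms(1,2), of "int l"] by (simp add: iter_def)
    ultimately show ?case
      using Suc assms(1) by (simp add: bij_betw_def inv_into_f_f flip: l_def)
  qed simp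
  have "nat (- j) \<le> m" "nat (int m + j) = m - nat (- j)"
    using False assms(3) by auto
  then show ?thesis
    using False *[of "nat (- j)"] by (simp add: iter_def)
qed

lemma iter_add_one:
  assumes "bij_betw f S S" "x \<in> S"
  shows "iter S f (j + 1) x = f (iter S f j x)"
    and "iter S f (j + 1) x = iter S f j (f x)"
proof -
  have "iter S f (j + 1) x = f (iter S f j x) \<and> iter S f (j + 1) x = iter S f j (f x)"
  proof (cases "0 \<le> j")
    case True
    then have "nat (j + 1) = Suc (nat j)" by simp
    then show ?thesis
      using True by (simp add: iter_def funpow_swap1)
  next
    case False
    define k where "k = nat (- j) - 1"
    have k: "nat (- j) = Suc k" "nat (- (j + 1)) = k"
      using False by (auto simp: k_def)
    have it: "iter S f (j + 1) x = (inv_into S f ^^ k) x"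
    proof (cases "j = -1")
      case True
      then show ?thesis using k by (simp add: iter_def)
    next
      case F: False
      then show ?thesis using False k by (simp add: iter_def)
    qed
    have "(inv_into S f ^^ k) x \<in> S"
      using iter_in[OF assms, of "j + 1"] it by simp
    then have "f (iter S f j x) = (inv_into S f ^^ k) x"
      using assms(1) False k by (simp add: iter_def bij_betw_def f_inv_into_f)
    moreover have "iter S f j (f x) = (inv_into S f ^^ k) x"
      using assms False k by (simp add: iter_def bij_betw_def inv_into_f_f funpow_Suc_right del: funpow.simps)
    ultimately show ?thesis using it by simp
  qed
  then show "iter S f (j + 1) x = f (iter S f j x)" "iter S f (j + 1) x = iter S f j (f x)"
    by auto
qed

text \<open>Two-sided orbits are dense by hypothesis, while forward iterates are what an invariant set with
  \<open>f ` C \<subseteq> C\<close> allows. The forward orbit of \<open>x\<close> accumulates at some \<open>w\<close>, the two-sided orbit of \<open>w\<close> comes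
  close to \<open>y\<close>, and a point \<open>f\<^sup>j w\<close> of it, even with \<open>j < 0\<close>, is a limit of forward iterates of \<open>x\<close>
  because arbitrarily late iterates approach \<open>w\<close>.\<close>
lemma forward_orbit_dense:
  fixes f :: "'a::metric_space \<Rightarrow> 'a"
  assumes "compact S" and bij: "bij_betw f S S"
    and cont: "continuous_on S f" "continuous_on S (inv_into S f)"
    and dense: "all_orbits_dense S f"
    and "x \<in> S" "y \<in> S" "0 < e"
  shows "\<exists>n. dist ((f ^^ n) x) y < e"
proof -
  have orb: "(f ^^ n) x \<in> S" for n
    using iter_in[OF bij \<open>x \<in> S\<close>, of "int n"] by (simp add: iter_def)
  then obtain w q where "w \<in> S" and q: "strict_mono (q :: nat \<Rightarrow> nat)"
      and lim: "((\<lambda>n. (f ^^ n) x) \<circ> q) \<longlonglongrightarrow> w"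
    using \<open>compact S\<close> unfolding compact_def by meson
  have "y \<in> closure (range (\<lambda>k. iter S f k w))"
    using dense \<open>w \<in> S\<close> \<open>y \<in> S\<close> by (auto simp: all_orbits_dense_def)
  then obtain j where j: "dist (iter S f j w) y < e"
    using \<open>0 < e\<close> by (auto simp: closure_approachable)
  have "(\<lambda>k. iter S f j ((f ^^ q k) x)) \<longlonglongrightarrow> iter S f j w"
    using continuous_on_iter[OF bij cont, of j] lim orb \<open>w \<in> S\<close>
    by (auto simp: continuous_on_sequentially o_def)
  then have "(\<lambda>k. dist (iter S f j ((f ^^ q k) x)) y) \<longlonglongrightarrow> dist (iter S f j w) y"
    by (intro tendsto_intros)
  then have "\<forall>\<^sub>F k in sequentially. dist (iter S f j ((f ^^ q k) x)) y < e"
    using j by (rule order_tendstoD)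
  moreover have "\<forall>\<^sub>F k in sequentially. nat (- j) \<le> k"
    by (rule eventually_ge_at_top)
  ultimately have "\<forall>\<^sub>F k in sequentially. dist (iter S f j ((f ^^ q k) x)) y < e \<and> nat (- j) \<le> k"
    by (rule eventually_conj)
  then obtain k where k: "dist (iter S f j ((f ^^ q k) x)) y < e" "nat (- j) \<le> k"
    by (auto simp: eventually_sequentially)
  have "k \<le> q k"
    using q by (rule strict_mono_imp_increasing)
  then have "0 \<le> int (q k) + j"
    using k(2) by linarith
  then show ?thesis
    using k(1) iter_after_funpow[OF bij \<open>x \<in> S\<close>] by metis
qed

section \<open>Minimality from a dense continuous embedding\<close>

text \<open>The two spaces are compared along sequences of \<open>M\<close> that converge in both of them. Such a sequence
  exists over any \<open>z\<close> in \<open>Z\<close>, by density of \<open>\<iota> ` M\<close> and compactness of \<open>S\<close>. If it tends to \<open>x\<close> in \<open>S\<close>,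
  its image under \<open>f\<^sup>n\<close> tends to \<open>f\<^sup>n x\<close> in \<open>S\<close> and to \<open>\<zeta>\<^sup>n z\<close> in \<open>Z\<close>; so whenever \<open>f\<^sup>n x\<close> is near a point
  \<open>y\<close> of \<open>M\<close>, continuity of \<open>\<iota>\<close> at \<open>y\<close> puts \<open>\<zeta>\<^sup>n z\<close> near \<open>\<iota> y\<close>.\<close>
lemma minimal_map_if_continuous_dense_embedding:
  fixes f :: "'a::metric_space \<Rightarrow> 'a" and Z :: "'z metric"
  assumes "compact S" and f: "continuous_on S f" "f ` S \<subseteq> S"
    and dense: "\<And>x y e. x \<in> S \<Longrightarrow> y \<in> S \<Longrightarrow> 0 < e \<Longrightarrow> \<exists>n. dist ((f ^^ n) x) y < e"
    and M: "M \<subseteq> S" "f ` M \<subseteq> M"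
    and \<iota>: "continuous_map (top_of_set M) (mtopology_of Z) \<iota>"
    and \<iota>_dense: "mtopology_of Z closure_of (\<iota> ` M) = mspace Z"
    and \<zeta>: "continuous_map (mtopology_of Z) (mtopology_of Z) \<zeta>"
    and \<zeta>\<iota>: "\<And>x. x \<in> M \<Longrightarrow> \<zeta> (\<iota> x) = \<iota> (f x)"
  shows "minimal_map (mtopology_of Z) \<zeta>"
  unfolding minimal_map_def
proof (intro allI impI)
  interpret Z: Metric_space "mspace Z" "mdist Z"
    by (rule Metric_space_mspace_mdist)
  have topZ: "mtopology_of Z = Z.mtopology"
    by (simp add: mtopology_of_def)
  fix C assume C: "closedin (mtopology_of Z) C \<and> \<zeta> ` C \<subseteq> C"
  show "C = {} \<or> C = topspace (mtopology_of Z)"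
  proof (cases "C = {}")
    case False
    then obtain z where "z \<in> C" by blast
    have CZ: "C \<subseteq> mspace Z"
      using C closedin_subset by fastforce
    then have "z \<in> Z.mtopology closure_of (\<iota> ` M)"
      using \<open>z \<in> C\<close> \<iota>_dense by (auto simp: topZ)
    then obtain \<sigma> where "range \<sigma> \<subseteq> \<iota> ` M" and \<sigma>: "limitin Z.mtopology \<sigma> z sequentially"
      unfolding Z.closure_of_sequentially by blast
    then have "\<forall>k. \<exists>m. m \<in> M \<and> \<sigma> k = \<iota> m" by blast
    then obtain u where u: "\<And>k. u k \<in> M" "\<And>k. \<sigma> k = \<iota> (u k)" by metis
    then obtain x q where "x \<in> S" and q: "strict_mono (q :: nat \<Rightarrow> nat)" and ux: "(u \<circ> q) \<longlonglongrightarrow> x"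
      using \<open>compact S\<close> \<open>M \<subseteq> S\<close> unfolding compact_def by (meson subsetD)
    have uz: "limitin Z.mtopology (\<lambda>k. \<iota> (u (q k))) z sequentially"
      using limitin_subsequence[OF q \<sigma>] u(2) by (simp add: o_def)
    have iterM: "(f ^^ n) m \<in> M" if "m \<in> M" for n m
      using that M(2) by (induction n) auto
    have conv_S: "(\<lambda>k. (f ^^ n) (u (q k))) \<longlonglongrightarrow> (f ^^ n) x \<and> (f ^^ n) x \<in> S" for n
    proof (induction n)
      case (Suc n)
      have "(f ^^ n) (u (q k)) \<in> S" for k
        using iterM u(1) M(1) by blast
      then show ?case
        using Suc f by (auto simp: continuous_on_sequentially o_def)
    qed (use ux \<open>x \<in> S\<close> in \<open>simp_all add: o_def\<close>)
    have conv_Z: "limitin Z.mtopology (\<lambda>k. \<iota> ((f ^^ n) (u (q k)))) ((\<zeta> ^^ n) z) sequentially \<and>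
        (\<zeta> ^^ n) z \<in> C" for n
    proof (induction n)
      case (Suc n)
      then have "limitin Z.mtopology (\<lambda>k. \<zeta> (\<iota> ((f ^^ n) (u (q k))))) (\<zeta> ((\<zeta> ^^ n) z)) sequentially"
        using continuous_map_limit[OF \<zeta>[unfolded topZ]] by (force simp: o_def)
      then show ?case
        using Suc C iterM u(1) by (auto simp: \<zeta>\<iota>)
    qed (use uz \<open>z \<in> C\<close> in simp_all)
    have "\<iota> y \<in> C" if "y \<in> M" for y
    proof -
      have \<iota>y: "\<iota> y \<in> mspace Z"
        using \<iota> \<open>y \<in> M\<close> by (auto simp: continuous_map_def)
      have "\<exists>c\<in>C. c \<in> Z.mball (\<iota> y) r" if "0 < r" for r
      proof -
        obtain U where "openin (top_of_set M) U" "y \<in> U"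
            and U: "\<And>m. m \<in> U \<Longrightarrow> \<iota> m \<in> Z.mball (\<iota> y) (r/2)"
          using \<iota> \<open>y \<in> M\<close> \<open>0 < r\<close> unfolding topZ Z.continuous_map_to_metric
          by (metis half_gt_zero topspace_euclidean_subtopology)
        then obtain \<delta> where "0 < \<delta>" and \<delta>: "\<And>m. m \<in> M \<Longrightarrow> dist m y < \<delta> \<Longrightarrow> m \<in> U"
          by (metis openin_euclidean_subtopology_iff)
        have "y \<in> S" using \<open>y \<in> M\<close> \<open>M \<subseteq> S\<close> by blast
        then obtain n where n: "dist ((f ^^ n) x) y < \<delta>"
          using dense \<open>x \<in> S\<close> \<open>0 < \<delta>\<close> by blast
        have "(\<lambda>k. dist ((f ^^ n) (u (q k))) y) \<longlonglongrightarrow> dist ((f ^^ n) x) y"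
          using conv_S by (intro tendsto_intros) blast
        then have "\<forall>\<^sub>F k in sequentially. dist ((f ^^ n) (u (q k))) y < \<delta>"
          using n by (rule order_tendstoD)
        moreover have "\<forall>\<^sub>F k in sequentially. \<iota> ((f ^^ n) (u (q k))) \<in> mspace Z \<and>
            mdist Z (\<iota> ((f ^^ n) (u (q k)))) ((\<zeta> ^^ n) z) < r/2"
          using conv_Z[of n] half_gt_zero[OF \<open>0 < r\<close>] unfolding Z.limitin_metric by blast
        ultimately have "\<forall>\<^sub>F k in sequentially. dist ((f ^^ n) (u (q k))) y < \<delta> \<and>
            mdist Z (\<iota> ((f ^^ n) (u (q k)))) ((\<zeta> ^^ n) z) < r/2"
          by eventually_elim auto
        then obtain k where k: "dist ((f ^^ n) (u (q k))) y < \<delta>"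
            "mdist Z (\<iota> ((f ^^ n) (u (q k)))) ((\<zeta> ^^ n) z) < r/2"
          by (auto simp: eventually_sequentially)
        then have near: "\<iota> ((f ^^ n) (u (q k))) \<in> Z.mball (\<iota> y) (r/2)"
          using U \<delta> iterM u(1) by blast
        have "(\<zeta> ^^ n) z \<in> C" using conv_Z by blast
        then have "mdist Z (\<iota> y) ((\<zeta> ^^ n) z) < r"
          using near k(2) CZ Z.triangle[of "\<iota> y" "\<iota> ((f ^^ n) (u (q k)))" "(\<zeta> ^^ n) z"] by auto
        with \<open>(\<zeta> ^^ n) z \<in> C\<close> CZ \<iota>y show ?thesis by auto
      qed
      then have "\<iota> y \<in> Z.mtopology closure_of C"
        using \<iota>y by (simp add: Z.metric_closure_of)
      then show ?thesis
        using C by (simp add: topZ closure_of_closedin)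
    qed
    then have "mtopology_of Z closure_of (\<iota> ` M) \<subseteq> C"
      using C by (intro closure_of_minimal) auto
    then show ?thesis
      using \<iota>_dense CZ by auto
  qed auto
qed

section \<open>Invariance of domain for maps into a sphere\<close>

text \<open>Openness is local, and near a given image point \<open>p\<close> the values avoid the antipode \<open>b\<close> of \<open>p\<close>. The
  sphere without \<open>b\<close> is homeomorphic to the Euclidean space of the domain, where the usual invariance
  of domain applies.\<close>
lemma invariance_of_domain_into_sphere:
  fixes f :: "'a::euclidean_space \<Rightarrow> 'b::euclidean_space"
  assumes "DIM('b) = DIM('a) + 1" and "0 < r"
    and "open U" "continuous_on U f" "inj_on f U" "f ` U \<subseteq> sphere a r"
  shows "openin (top_of_set (sphere a r)) (f ` U)"
proof (subst openin_subopen, intro ballI)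
  fix p assume "p \<in> f ` U"
  \<comment> \<open>the antipode of \<open>p\<close>\<close>
  define b where "b = 2 *\<^sub>R a - p"
  have p: "p \<in> sphere a r"
    using \<open>p \<in> f ` U\<close> assms(6) by blast
  have "dist a b = dist a p"
    by (simp add: b_def dist_norm scaleR_2 norm_minus_commute algebra_simps)
  then have b: "b \<in> sphere a r"
    using p by simp
  have "b \<noteq> p"
  proof
    assume "b = p"
    then have "2 *\<^sub>R a = 2 *\<^sub>R p"
      by (simp add: b_def scaleR_2 algebra_simps)
    then show False using p \<open>0 < r\<close> by simp
  qed
  have "(sphere a r - {b}) homeomorphic (UNIV :: 'a set)"
    using assms(1,2) b by (intro homeomorphic_punctured_sphere_affine) auto
  then obtain g h where gh: "homeomorphism (sphere a r - {b}) (UNIV :: 'a set) g h"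
    by (auto simp: homeomorphic_def)
  define V where "V = {x \<in> U. f x \<in> - {b}}"
  have "open V"
    unfolding V_def using assms(3,4) continuous_on_open_vimage[of U f]
    by (metis (no_types, lifting) Collect_cong Int_commute Int_def open_delete open_UNIV Compl_eq_Diff_UNIV vimage_eq)
  have V: "V \<subseteq> U" "f ` V \<subseteq> sphere a r - {b}"
    using assms(6) by (auto simp: V_def)
  have "open ((g \<circ> f) ` V)"
  proof (rule invariance_of_domain[OF _ \<open>open V\<close>])
    show "continuous_on V (g \<circ> f)"
      using V assms(4) gh
      by (intro continuous_on_compose) (auto simp: homeomorphism_def intro: continuous_on_subset)
    have "inj_on g (sphere a r - {b})"
      using gh by (metis homeomorphism_def inj_on_inverseI)
    then show "inj_on (g \<circ> f) V"
      using V assms(5) by (intro comp_inj_on) (auto intro: inj_on_subset)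
  qed
  then have "openin (top_of_set (sphere a r - {b})) (h ` (g \<circ> f) ` V)"
    using homeomorphism_imp_open_map[OF homeomorphism_symD[OF gh]] by simp
  moreover have "h ` (g \<circ> f) ` V = f ` V"
  proof -
    have "h (g (f v)) = f v" if "v \<in> V" for v
      using gh V that by (auto simp: homeomorphism_def)
    then show ?thesis by (force simp: image_image)
  qed
  moreover have "openin (top_of_set (sphere a r)) (sphere a r - {b})"
    by (simp add: openin_delete)
  ultimately have "openin (top_of_set (sphere a r)) (f ` V)"
    by (metis openin_trans)
  then show "\<exists>T. openin (top_of_set (sphere a r)) T \<and> p \<in> T \<and> T \<subseteq> f ` U"
    using \<open>p \<in> f ` U\<close> \<open>b \<noteq> p\<close> V(1) by (intro exI[of _ "f ` V"]) (auto simp: V_def)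
qed

section \<open>The tube around a flow line\<close>

locale flow_tube =
  fixes \<phi> :: "real^'m \<Rightarrow> real^'m" and \<epsilon> :: real and \<tau>\<^sub>0 :: "real \<times> (real^'n) \<Rightarrow> real^'m"
  assumes bij: "bij_betw \<phi> (sphere 0 1) (sphere 0 1)"
    and cont: "continuous_on (sphere 0 1) \<phi>" "continuous_on (sphere 0 1) (inv_into (sphere 0 1) \<phi>)"
    and \<epsilon>: "0 < \<epsilon>"
    and \<tau>\<^sub>0_cont: "continuous_on ({-\<epsilon>..1 + \<epsilon>} \<times> cball 0 1) \<tau>\<^sub>0"
    and \<tau>\<^sub>0_sphere: "\<tau>\<^sub>0 ` ({-\<epsilon>..1 + \<epsilon>} \<times> cball 0 1) \<subseteq> sphere 0 1"
    and \<tau>\<^sub>0_glue: "\<And>s x. \<bar>s\<bar> \<le> \<epsilon> \<Longrightarrow> x \<in> cball 0 1 \<Longrightarrow> \<tau>\<^sub>0 (s + 1, x) = \<phi> (\<tau>\<^sub>0 (s, x))"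
begin

lemma \<tau>\<^sub>0_in_sphere: "0 \<le> s \<Longrightarrow> s \<le> 1 \<Longrightarrow> norm x \<le> 1 \<Longrightarrow> \<tau>\<^sub>0 (s, x) \<in> sphere 0 1"
  using \<tau>\<^sub>0_sphere \<epsilon> by (auto simp: image_subset_iff)

lemma tau_in_sphere: "norm x \<le> 1 \<Longrightarrow> tau \<phi> \<tau>\<^sub>0 (s, x) \<in> sphere 0 1"
  unfolding tau_def split using iter_in[OF bij \<tau>\<^sub>0_in_sphere] frac_lt_1[of s] frac_ge_0[of s]
  by (meson less_imp_le)

lemma tau_add_one:
  assumes "norm x \<le> 1"
  shows "tau \<phi> \<tau>\<^sub>0 (s + 1, x) = \<phi> (tau \<phi> \<tau>\<^sub>0 (s, x))"
proof -
  have "\<tau>\<^sub>0 (frac s, x) \<in> sphere 0 1"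
    using assms frac_lt_1[of s] frac_ge_0[of s] by (intro \<tau>\<^sub>0_in_sphere) auto
  moreover have "frac (s + 1) = frac s" "\<lfloor>s + 1\<rfloor> = \<lfloor>s\<rfloor> + 1"
    by (auto simp: frac_def)
  ultimately show ?thesis
    using iter_add_one(1)[OF bij] by (simp add: tau_def)
qed

text \<open>On \<open>[j, j + 1)\<close> this is the definition. That the same formula holds at the right end point, where
  the floor jumps, is the gluing condition \<open>\<tau>\<^sub>0 (1, x) = \<phi> (\<tau>\<^sub>0 (0, x))\<close>; this is why \<open>\<tau>\<close> is continuous
  across integer times.\<close>
lemma tau_on_slab:
  assumes "of_int j \<le> s" "s \<le> of_int j + 1" "norm x \<le> 1"
  shows "tau \<phi> \<tau>\<^sub>0 (s, x) = iter (sphere 0 1) \<phi> j (\<tau>\<^sub>0 (s - of_int j, x))"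
proof (cases "s = of_int j + 1")
  case True
  then have s: "\<lfloor>s\<rfloor> = j + 1" "frac s = 0" "s - of_int j = 0 + 1"
    by (auto simp: frac_def)
  have "tau \<phi> \<tau>\<^sub>0 (s, x) = iter (sphere 0 1) \<phi> (j + 1) (\<tau>\<^sub>0 (0, x))"
    unfolding tau_def split s(1,2) ..
  moreover have "\<tau>\<^sub>0 (0 + 1, x) = \<phi> (\<tau>\<^sub>0 (0, x))"
    using \<epsilon> assms(3) by (intro \<tau>\<^sub>0_glue) auto
  ultimately show ?thesis
    using iter_add_one(2)[OF bij, of "\<tau>\<^sub>0 (0, x)"] \<tau>\<^sub>0_in_sphere[of 0 x] assms(3) s(3) by simp
next
  case False
  then have "\<lfloor>s\<rfloor> = j"
    using assms by linarith
  then show ?thesis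
    by (simp add: tau_def frac_def)
qed

lemma continuous_on_tau: "continuous_on ({- real N..real N} \<times> cball 0 1) (tau \<phi> \<tau>\<^sub>0)"
proof -
  define I where "I = (\<lambda>j. {of_int j..of_int j + 1 :: real} \<times> cball (0 :: real^'n) 1)"
  have "continuous_on (I j) (tau \<phi> \<tau>\<^sub>0)" for j
  proof -
    let ?g = "\<lambda>p :: real \<times> (real^'n). \<tau>\<^sub>0 (fst p - of_int j, snd p)"
    have "continuous_on (I j) ?g"
      by (rule continuous_on_compose2[OF \<tau>\<^sub>0_cont])
        (use \<epsilon> in \<open>auto simp: I_def intro!: continuous_intros\<close>)
    moreover have "?g ` I j \<subseteq> sphere 0 1"
      using \<tau>\<^sub>0_in_sphere by (auto simp: I_def)
    ultimately have "continuous_on (I j) (\<lambda>p. iter (sphere 0 1) \<phi> j (?g p))"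
      by (rule continuous_on_compose2[OF continuous_on_iter[OF bij cont]])
    then show ?thesis
      by (rule continuous_on_eq) (auto simp: I_def tau_on_slab)
  qed
  then have "continuous_on (\<Union>j\<in>{- int N..int N}. I j) (tau \<phi> \<tau>\<^sub>0)"
    by (intro continuous_on_closed_Union) (auto simp: I_def intro!: closed_Times)
  moreover have "p \<in> (\<Union>j\<in>{- int N..int N}. I j)" if "p \<in> {- real N..real N} \<times> cball 0 1" for p
  proof -
    obtain s x where p: "p = (s, x)" by force
    have "- int N \<le> \<lfloor>s\<rfloor>" "\<lfloor>s\<rfloor> \<le> int N"
      using that by (auto simp: p le_floor_iff floor_le_iff)
    then show ?thesis
      using that by (intro UN_I[of "\<lfloor>s\<rfloor>"]) (auto simp: I_def p)
  qed
  ultimately show ?thesis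
    by (meson continuous_on_subset subsetI)
qed

text \<open>In other words, \<open>\<phi>\<close> maps the complement of \<open>L\<^sub>\<infinity>\<close> into itself, so that the relation
  \<open>\<zeta> (\<iota> x) = \<iota> (\<phi> x)\<close> can be iterated there.\<close>
lemma L_inf_backward_invariant:
  assumes "x \<in> sphere 0 1" "\<phi> x \<in> L_inf \<phi> \<tau>\<^sub>0"
  shows "x \<in> L_inf \<phi> \<tau>\<^sub>0"
proof -
  obtain s where "\<phi> x = tau \<phi> \<tau>\<^sub>0 (s, 0)"
    using assms(2) by (auto simp: L_inf_def)
  then have "\<phi> x = \<phi> (tau \<phi> \<tau>\<^sub>0 (s - 1, 0))"
    using tau_add_one[of 0 "s - 1"] by simp
  then have "x = tau \<phi> \<tau>\<^sub>0 (s - 1, 0)"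
    using bij assms(1) tau_in_sphere[of 0] by (auto simp: bij_betw_def inj_on_def)
  then show ?thesis by (auto simp: L_inf_def)
qed

end

section \<open>Continuity of the blow-up maps\<close>

text \<open>This form makes the continuity of \<open>r\<^sub>n\<close> evident.\<close>
lemma rad_eq_max_min:
  assumes "0 < \<rho> n" "\<rho> n \<le> real n"
  shows "rad \<rho> n s = max 0 (min (\<rho> n) (real n - \<bar>s\<bar>))"
  using assms by (auto simp: rad_def)

locale blown_up_tube = flow_tube \<phi> \<epsilon> \<tau>\<^sub>0
  for \<phi> :: "real^'m \<Rightarrow> real^'m" and \<epsilon> :: real and \<tau>\<^sub>0 :: "real \<times> (real^'n) \<Rightarrow> real^'m" +
  fixes \<rho> :: "nat \<Rightarrow> real" and n :: nat
  assumes dim: "CARD('m) = CARD('n) + 2"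
    and \<rho>: "0 < \<rho> n" "2 * \<rho> n \<le> 1" "1 \<le> n"
    and inj: "inj_on (tau \<phi> \<tau>\<^sub>0) ({- real n - 2..real n + 2} \<times> cball 0 (2 * \<rho> n))"
begin

abbreviation chart_dom :: "(real \<times> (real^'n)) set" where
  "chart_dom \<equiv> {- real n - 2..real n + 2} \<times> cball 0 (2 * \<rho> n)"

definition tube :: "(real \<times> (real^'n)) set" where
  "tube = {(s, x). \<bar>s\<bar> \<le> real n \<and> norm x \<le> 2 * rad \<rho> n s}"

definition open_tube :: "(real \<times> (real^'n)) set" where
  "open_tube = {(s, x). norm x < 2 * rad \<rho> n s}"

text \<open>The blow-up \<open>\<beta>\<^sub>n\<close> in tube coordinates: in terms of \<open>t = \<bar>x\<bar>\<close> and the direction \<open>x / \<bar>x\<bar>\<close>, the radius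
  \<open>t\<close> is replaced by \<open>t/2 + r\<^sub>n(s)\<close>.\<close>
definition push :: "real \<times> (real^'n) \<Rightarrow> real \<times> (real^'n)" where
  "push = (\<lambda>(s, x). (s, (1/2 + rad \<rho> n s / norm x) *\<^sub>R x))"

lemma rad_eq: "rad \<rho> n s = max 0 (min (\<rho> n) (real n - \<bar>s\<bar>))"
  using \<rho> by (intro rad_eq_max_min) auto

lemma rad_bounds: "0 \<le> rad \<rho> n s" "rad \<rho> n s \<le> \<rho> n"
  using \<rho>(1) by (auto simp: rad_eq)

lemma open_tube_subset_tube: "open_tube \<subseteq> tube"
  by (auto simp: open_tube_def tube_def rad_eq split: if_splits)
    (smt (verit) norm_ge_zero)+

lemma tube_subset_chart_dom: "tube \<subseteq> chart_dom"
  using rad_bounds(2) by (force simp: tube_def intro: order_trans)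

lemma chart_dom_subset: "chart_dom \<subseteq> {- real (n + 2)..real (n + 2)} \<times> cball 0 1"
  using \<rho> by auto

lemma continuous_on_tau_chart_dom: "continuous_on chart_dom (tau \<phi> \<tau>\<^sub>0)"
  using continuous_on_tau chart_dom_subset by (rule continuous_on_subset)

lemma tau_chart_dom_in_sphere: "p \<in> chart_dom \<Longrightarrow> tau \<phi> \<tau>\<^sub>0 p \<in> sphere 0 1"
  using tau_in_sphere[of "snd p" "fst p"] \<rho>(2) by (cases p) auto

lemma compact_chart_dom: "compact chart_dom"
  by (intro compact_Times) auto

lemma compact_tube: "compact tube"
proof -
  have "closed {p :: real \<times> (real^'n). \<bar>fst p\<bar> \<le> real n \<and> norm (snd p) \<le> 2 * rad \<rho> n (fst p)}"
    unfolding rad_eq by (intro closed_Collect_conj closed_Collect_le continuous_intros)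
  also have "{p :: real \<times> (real^'n). \<bar>fst p\<bar> \<le> real n \<and> norm (snd p) \<le> 2 * rad \<rho> n (fst p)} = tube"
    by (auto simp: tube_def)
  finally show ?thesis
    using compact_chart_dom tube_subset_chart_dom compact_Int_closed by (metis inf.absorb2)
qed

lemma open_open_tube: "open open_tube"
proof -
  have "open {p :: real \<times> (real^'n). norm (snd p) < 2 * rad \<rho> n (fst p)}"
    unfolding rad_eq by (intro open_Collect_less continuous_intros)
  also have "{p :: real \<times> (real^'n). norm (snd p) < 2 * rad \<rho> n (fst p)} = open_tube"
    by (auto simp: open_tube_def)
  finally show ?thesis .
qed

text \<open>Without this, points outside the tube, which \<open>\<beta>\<^sub>n\<close> fixes, could accumulate at points of the tube
  that \<open>\<beta>\<^sub>n\<close> moves.\<close>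
lemma openin_tau_open_tube: "openin (top_of_set (sphere 0 1)) (tau \<phi> \<tau>\<^sub>0 ` open_tube)"
proof -
  have sub: "open_tube \<subseteq> chart_dom"
    using open_tube_subset_tube tube_subset_chart_dom by blast
  show ?thesis
  proof (rule invariance_of_domain_into_sphere[OF _ _ open_open_tube])
    show "tau \<phi> \<tau>\<^sub>0 ` open_tube \<subseteq> sphere 0 1"
      using sub tau_chart_dom_in_sphere by blast
  qed (use sub dim continuous_on_tau_chart_dom inj in \<open>auto intro: continuous_on_subset inj_on_subset\<close>)
qed

lemma push_in_chart_dom:
  assumes "(s, x) \<in> tube" "x \<noteq> 0"
  shows "push (s, x) \<in> chart_dom"
proof -
  have "norm ((1/2 + rad \<rho> n s / norm x) *\<^sub>R x) = norm x / 2 + rad \<rho> n s"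
    using assms(2) rad_bounds(1)[of s] by (simp add: field_simps)
  also have "\<dots> \<le> 2 * \<rho> n"
    using assms(1) rad_bounds(2)[of s] by (auto simp: tube_def)
  finally show ?thesis
    using assms(1) by (auto simp: push_def tube_def)
qed

lemma continuous_on_push: "continuous_on {p. snd p \<noteq> 0} push"
  unfolding push_def rad_eq case_prod_beta by (intro continuous_intros) auto

text \<open>The description operator in the definition of \<open>\<beta>\<^sub>n\<close> is resolved by injectivity of \<open>\<tau>\<close>: a point of the
  tube determines \<open>s\<close> and the vector \<open>t x\<close>, hence \<open>t\<close> and the unit vector \<open>x\<close>.\<close>
lemma beta_tau:
  assumes "(s, x) \<in> tube" "x \<noteq> 0"
  shows "beta \<phi> \<tau>\<^sub>0 \<rho> n (tau \<phi> \<tau>\<^sub>0 (s, x)) = tau \<phi> \<tau>\<^sub>0 (push (s, x))"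
proof -
  have "tau \<phi> \<tau>\<^sub>0 (s, x) \<in> R_set \<phi> \<tau>\<^sub>0 \<rho> n"
    using assms by (auto simp: R_set_def tube_def)
  moreover have "(THE z. \<exists>s' t x'. - real n \<le> s' \<and> s' \<le> real n \<and> 0 < t \<and> t \<le> 2 * rad \<rho> n s' \<and>
      norm x' = 1 \<and> tau \<phi> \<tau>\<^sub>0 (s, x) = tau \<phi> \<tau>\<^sub>0 (s', t *\<^sub>R x') \<and>
      z = tau \<phi> \<tau>\<^sub>0 (s', (t / 2 + rad \<rho> n s') *\<^sub>R x')) = tau \<phi> \<tau>\<^sub>0 (push (s, x))"
  proof (rule the_equality)
    show "\<exists>s' t x'. - real n \<le> s' \<and> s' \<le> real n \<and> 0 < t \<and> t \<le> 2 * rad \<rho> n s' \<and>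
      norm x' = 1 \<and> tau \<phi> \<tau>\<^sub>0 (s, x) = tau \<phi> \<tau>\<^sub>0 (s', t *\<^sub>R x') \<and>
      tau \<phi> \<tau>\<^sub>0 (push (s, x)) = tau \<phi> \<tau>\<^sub>0 (s', (t / 2 + rad \<rho> n s') *\<^sub>R x')"
      using assms
      by (intro exI[of _ s] exI[of _ "norm x"] exI[of _ "x /\<^sub>R norm x"])
        (auto simp: tube_def push_def field_simps)
  next
    fix z assume "\<exists>s' t x'. - real n \<le> s' \<and> s' \<le> real n \<and> 0 < t \<and> t \<le> 2 * rad \<rho> n s' \<and>
      norm x' = 1 \<and> tau \<phi> \<tau>\<^sub>0 (s, x) = tau \<phi> \<tau>\<^sub>0 (s', t *\<^sub>R x') \<and>
      z = tau \<phi> \<tau>\<^sub>0 (s', (t / 2 + rad \<rho> n s') *\<^sub>R x')"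
    then obtain s' t x' where *: "- real n \<le> s'" "s' \<le> real n" "0 < t" "t \<le> 2 * rad \<rho> n s'"
        "norm x' = 1" "tau \<phi> \<tau>\<^sub>0 (s, x) = tau \<phi> \<tau>\<^sub>0 (s', t *\<^sub>R x')"
        "z = tau \<phi> \<tau>\<^sub>0 (s', (t / 2 + rad \<rho> n s') *\<^sub>R x')"
      by blast
    then have "(s', t *\<^sub>R x') \<in> tube"
      by (auto simp: tube_def)
    then have "(s, x) = (s', t *\<^sub>R x')"
      using assms(1) *(6) tube_subset_chart_dom by (intro inj_onD[OF inj]) auto
    then have "push (s, x) = (s', (t / 2 + rad \<rho> n s') *\<^sub>R x')"
      using *(3,5) by (simp add: push_def algebra_simps)
    then show "z = tau \<phi> \<tau>\<^sub>0 (push (s, x))"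
      using *(7) by simp
  qed
  ultimately show ?thesis
    by (simp add: beta_def)
qed

lemma tube_off_core_cases:
  assumes "y \<in> tau \<phi> \<tau>\<^sub>0 ` tube" "y \<notin> L_fin \<phi> \<tau>\<^sub>0 n"
  obtains s x where "(s, x) \<in> tube" "x \<noteq> 0" "y = tau \<phi> \<tau>\<^sub>0 (s, x)"
proof -
  obtain s x where sx: "(s, x) \<in> tube" "y = tau \<phi> \<tau>\<^sub>0 (s, x)"
    using assms(1) by auto
  then have "x \<noteq> 0"
    using assms(2) by (auto simp: L_fin_def tube_def abs_le_iff)
  then show thesis
    using that sx by blast
qed

text \<open>This covers the points of \<open>R\<^sub>n\<close> with \<open>\<bar>x\<bar> = 2 r\<^sub>n(s)\<close> too, since \<open>t/2 + r = t\<close> for \<open>t = 2 r\<close>.\<close>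
lemma beta_off_open_tube:
  assumes "y \<notin> tau \<phi> \<tau>\<^sub>0 ` open_tube"
  shows "beta \<phi> \<tau>\<^sub>0 \<rho> n y = y"
proof (cases "y \<in> R_set \<phi> \<tau>\<^sub>0 \<rho> n")
  case True
  then obtain s x where "y = tau \<phi> \<tau>\<^sub>0 (s, x)" "- real n \<le> s" "s \<le> real n" "0 < norm x"
      "norm x \<le> 2 * rad \<rho> n s"
    by (auto simp: R_set_def)
  then have sx: "(s, x) \<in> tube" "x \<noteq> 0" "y = tau \<phi> \<tau>\<^sub>0 (s, x)"
    by (auto simp: tube_def)
  have "norm x = 2 * rad \<rho> n s"
    using sx assms by (force simp: open_tube_def tube_def)
  then have "rad \<rho> n s = norm x / 2" by simp
  then have half: "rad \<rho> n s / norm x = 1/2"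
    using sx(2) by simp
  have "push (s, x) = (s, x)"
    unfolding push_def prod.case half by simp
  then show ?thesis
    using beta_tau sx by simp
qed (simp add: beta_def)

lemma beta_in_sphere:
  assumes "y \<in> sphere 0 1" "y \<notin> L_fin \<phi> \<tau>\<^sub>0 n"
  shows "beta \<phi> \<tau>\<^sub>0 \<rho> n y \<in> sphere 0 1"
proof (cases "y \<in> tau \<phi> \<tau>\<^sub>0 ` open_tube")
  case True
  then have "y \<in> tau \<phi> \<tau>\<^sub>0 ` tube"
    using open_tube_subset_tube by blast
  then show ?thesis
    using tube_off_core_cases[OF _ assms(2)] beta_tau push_in_chart_dom tau_chart_dom_in_sphere by metis
qed (use assms beta_off_open_tube in simp)

text \<open>The domain is the union of its intersection with the closed tube and its part off the open tube.
  Both are relatively closed, the first because the closed tube is compact and the second by invariance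
  of domain. On the first, \<open>\<beta>\<^sub>n\<close> is \<open>push\<close> conjugated by \<open>\<tau>\<close>, whose inverse is continuous by compactness; on
  the second, \<open>\<beta>\<^sub>n\<close> is the identity.\<close>
lemma continuous_on_beta: "continuous_on (sphere 0 1 - L_fin \<phi> \<tau>\<^sub>0 n) (beta \<phi> \<tau>\<^sub>0 \<rho> n)"
proof -
  define W where "W = sphere 0 1 - L_fin \<phi> \<tau>\<^sub>0 n"
  define A where "A = W \<inter> tau \<phi> \<tau>\<^sub>0 ` tube"
  define B where "B = W - tau \<phi> \<tau>\<^sub>0 ` open_tube"
  have AB: "A \<union> B = W"
    using open_tube_subset_tube by (auto simp: A_def B_def)
  have "closedin (top_of_set W) A"
    unfolding A_def
    by (intro closedin_closed_Int compact_imp_closed compact_continuous_image compact_tube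
        continuous_on_subset[OF continuous_on_tau_chart_dom tube_subset_chart_dom])
  moreover have "closedin (top_of_set W) B"
  proof -
    obtain G where "open G" and G: "tau \<phi> \<tau>\<^sub>0 ` open_tube = sphere 0 1 \<inter> G"
      using openin_tau_open_tube by (auto simp: openin_open)
    have "B = W \<inter> - G"
      by (auto simp: B_def G W_def)
    then show ?thesis
      using \<open>open G\<close> by (simp add: closedin_closed_Int closed_Compl)
  qed
  moreover have "continuous_on A (beta \<phi> \<tau>\<^sub>0 \<rho> n)"
  proof -
    let ?g = "the_inv_into chart_dom (tau \<phi> \<tau>\<^sub>0)"
    have g: "?g (tau \<phi> \<tau>\<^sub>0 p) = p" if "p \<in> tube" for p
      using that tube_subset_chart_dom by (intro the_inv_into_f_f[OF inj]) auto
    have Ag: "\<exists>s x. (s, x) \<in> tube \<and> x \<noteq> 0 \<and> y = tau \<phi> \<tau>\<^sub>0 (s, x) \<and> ?g y = (s, x)" if "y \<in> A" for y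
      using that tube_off_core_cases[of y] g by (metis A_def W_def DiffD2 IntE)
    have "A \<subseteq> tau \<phi> \<tau>\<^sub>0 ` chart_dom"
      using tube_subset_chart_dom by (auto simp: A_def)
    then have cg: "continuous_on A ?g"
      by (rule continuous_on_subset[OF continuous_on_inv_into[OF continuous_on_tau_chart_dom compact_chart_dom inj]])
    have "continuous_on A (\<lambda>y. push (?g y))"
      by (rule continuous_on_compose2[OF continuous_on_push cg]) (use Ag in force)
    then have "continuous_on A (\<lambda>y. tau \<phi> \<tau>\<^sub>0 (push (?g y)))"
      by (rule continuous_on_compose2[OF continuous_on_tau_chart_dom]) (use Ag push_in_chart_dom in \<open>force simp del: mem_Times_iff\<close>)
    then show ?thesis
      by (rule continuous_on_eq) (use Ag beta_tau in force)
  qed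
  moreover have "continuous_on B (beta \<phi> \<tau>\<^sub>0 \<rho> n)"
    by (rule continuous_on_eq[OF continuous_on_id]) (simp add: B_def beta_off_open_tube)
  ultimately have "continuous_on (A \<union> B) (beta \<phi> \<tau>\<^sub>0 \<rho> n)"
    unfolding AB[symmetric] by (rule continuous_on_Un_local)
  then show ?thesis
    by (simp add: AB W_def)
qed

lemma continuous_on_dist_fin:
  assumes "mtopology_of d\<^sub>0 = top_of_set (sphere 0 1)"
    and "y \<in> sphere 0 1 - L_fin \<phi> \<tau>\<^sub>0 n"
  shows "continuous_on (sphere 0 1 - L_fin \<phi> \<tau>\<^sub>0 n) (\<lambda>x. dist_fin \<phi> \<tau>\<^sub>0 \<rho> d\<^sub>0 n x y)"
proof -
  let ?W = "sphere 0 1 - L_fin \<phi> \<tau>\<^sub>0 n"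
  have "continuous_map (top_of_set ?W) (mtopology_of d\<^sub>0) (beta \<phi> \<tau>\<^sub>0 \<rho> n)"
    using continuous_on_beta beta_in_sphere
    by (force simp: assms(1) continuous_map_in_subtopology)
  moreover have "continuous_map (top_of_set ?W) (mtopology_of d\<^sub>0) (\<lambda>x. beta \<phi> \<tau>\<^sub>0 \<rho> n y)"
    using beta_in_sphere assms by (simp flip: topspace_mtopology_of)
  ultimately have "continuous_map (top_of_set ?W) euclidean
      (\<lambda>x. mdist d\<^sub>0 (beta \<phi> \<tau>\<^sub>0 \<rho> n x) (beta \<phi> \<tau>\<^sub>0 \<rho> n y))"
    by (rule continuous_map_mdist)
  then show ?thesis
    by (simp add: dist_fin_def)
qed

end

section \<open>Continuity of the limit metric and minimality\<close>

lemma compact_space_imp_mdist_bounded: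
  assumes "compact_space (mtopology_of m)"
  obtains b where "\<And>x y. x \<in> mspace m \<Longrightarrow> y \<in> mspace m \<Longrightarrow> mdist m x y \<le> b"
proof -
  interpret Metric_space "mspace m" "mdist m"
    by (rule Metric_space_mspace_mdist)
  have "mbounded (mspace m)"
    using assms by (intro compactin_imp_mbounded) (simp add: compact_space_def mtopology_of_def)
  then show thesis
    using that by (auto simp: mbounded_alt)
qed

context flow_tube
begin

text \<open>The terms of the series are continuous, and \<open>d\<^sub>0\<close> is bounded on the compact sphere, so the weights
  \<open>2\<^sup>-\<^sup>n\<close> make the convergence uniform.\<close>
lemma continuous_on_dist_inf:
  assumes tube: "\<And>n. 1 \<le> n \<Longrightarrow> blown_up_tube \<phi> \<epsilon> \<tau>\<^sub>0 \<rho> n"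
    and top: "mtopology_of d\<^sub>0 = top_of_set (sphere 0 1)"
    and y: "y \<in> sphere 0 1 - L_inf \<phi> \<tau>\<^sub>0"
  shows "continuous_on (sphere 0 1 - L_inf \<phi> \<tau>\<^sub>0) (\<lambda>x. dist_inf \<phi> \<tau>\<^sub>0 \<rho> d\<^sub>0 x y)"
proof -
  let ?M = "sphere 0 1 - L_inf \<phi> \<tau>\<^sub>0"
  have space: "mspace d\<^sub>0 = sphere 0 1"
    using arg_cong[OF top, of topspace] by simp
  have off_core: "?M \<subseteq> sphere 0 1 - L_fin \<phi> \<tau>\<^sub>0 n" for n
    by (auto simp: L_inf_def L_fin_def)
  have "compact_space (mtopology_of d\<^sub>0)"
    by (simp add: top compact_space_subtopology)
  then obtain b where b: "\<And>p q. p \<in> sphere 0 1 \<Longrightarrow> q \<in> sphere 0 1 \<Longrightarrow> mdist d\<^sub>0 p q \<le> b"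
    using compact_space_imp_mdist_bounded space by metis
  have unif: "uniform_limit ?M (\<lambda>N x. \<Sum>n<N. (1/2) ^ Suc n * dist_fin \<phi> \<tau>\<^sub>0 \<rho> d\<^sub>0 (Suc n) x y)
      (\<lambda>x. \<Sum>n. (1/2) ^ Suc n * dist_fin \<phi> \<tau>\<^sub>0 \<rho> d\<^sub>0 (Suc n) x y) sequentially"
  proof (rule Weierstrass_m_test)
    fix n x assume "x \<in> ?M"
    then have "dist_fin \<phi> \<tau>\<^sub>0 \<rho> d\<^sub>0 (Suc n) x y \<le> b"
      unfolding dist_fin_def using y off_core[of "Suc n"]
      by (intro b blown_up_tube.beta_in_sphere[OF tube]) auto
    then show "norm ((1/2) ^ Suc n * dist_fin \<phi> \<tau>\<^sub>0 \<rho> d\<^sub>0 (Suc n) x y) \<le> (1/2) ^ Suc n * b"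
      by (simp add: dist_fin_def abs_mult)
  next
    show "summable (\<lambda>n. (1/2) ^ Suc n * b)"
      by (intro summable_mult2) (simp add: summable_geometric)
  qed
  have partial: "continuous_on ?M (\<lambda>x. \<Sum>n<N. (1/2) ^ Suc n * dist_fin \<phi> \<tau>\<^sub>0 \<rho> d\<^sub>0 (Suc n) x y)" for N
  proof (intro continuous_intros)
    fix n
    show "continuous_on ?M (\<lambda>x. dist_fin \<phi> \<tau>\<^sub>0 \<rho> d\<^sub>0 (Suc n) x y)"
    proof (rule continuous_on_subset[OF blown_up_tube.continuous_on_dist_fin[OF tube top] off_core])
      show "1 \<le> Suc n" by simp
      show "y \<in> sphere 0 1 - L_fin \<phi> \<tau>\<^sub>0 (Suc n)"
        using y off_core[of "Suc n"] by (rule rev_subsetD)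
    qed
  qed
  show ?thesis
    unfolding dist_inf_def using partial unif
    by (intro uniform_limit_theorem[OF always_eventually unif]) auto
qed

lemma continuous_map_completion_embedding:
  assumes "\<And>n. 1 \<le> n \<Longrightarrow> blown_up_tube \<phi> \<epsilon> \<tau>\<^sub>0 \<rho> n"
    and "mtopology_of d\<^sub>0 = top_of_set (sphere 0 1)"
    and compl: "is_completion (sphere 0 1 - L_inf \<phi> \<tau>\<^sub>0) (dist_inf \<phi> \<tau>\<^sub>0 \<rho> d\<^sub>0) Z \<iota>"
  shows "continuous_map (top_of_set (sphere 0 1 - L_inf \<phi> \<tau>\<^sub>0)) (mtopology_of Z) \<iota>"
proof -
  let ?M = "sphere 0 1 - L_inf \<phi> \<tau>\<^sub>0"
  interpret Z: Metric_space "mspace Z" "mdist Z"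
    by (rule Metric_space_mspace_mdist)
  have \<iota>: "\<And>x. x \<in> ?M \<Longrightarrow> \<iota> x \<in> mspace Z"
    and d: "\<And>x y. x \<in> ?M \<Longrightarrow> y \<in> ?M \<Longrightarrow> mdist Z (\<iota> x) (\<iota> y) = dist_inf \<phi> \<tau>\<^sub>0 \<rho> d\<^sub>0 x y"
    using compl by (auto simp: is_completion_def)
  have "\<exists>U. openin (top_of_set ?M) U \<and> y \<in> U \<and> (\<forall>x\<in>U. \<iota> x \<in> Z.mball (\<iota> y) r)"
    if y: "y \<in> ?M" and "0 < r" for y r
  proof (intro exI conjI ballI)
    let ?U = "{x \<in> ?M. dist_inf \<phi> \<tau>\<^sub>0 \<rho> d\<^sub>0 x y < r}"
    have "openin (top_of_set ?M) (?M \<inter> (\<lambda>x. dist_inf \<phi> \<tau>\<^sub>0 \<rho> d\<^sub>0 x y) -` {..<r})"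
      by (intro continuous_openin_preimage_gen continuous_on_dist_inf assms y) auto
    also have "?M \<inter> (\<lambda>x. dist_inf \<phi> \<tau>\<^sub>0 \<rho> d\<^sub>0 x y) -` {..<r} = ?U"
      by auto
    finally show "openin (top_of_set ?M) ?U" .
    show "y \<in> ?U"
      using y \<iota>[OF y] \<open>0 < r\<close> d[OF y y] by auto
    show "\<iota> x \<in> Z.mball (\<iota> y) r" if "x \<in> ?U" for x
      using that y \<iota> d[of x y] by (simp add: Z.commute)
  qed
  then show ?thesis
    by (simp add: mtopology_of_def Z.continuous_map_to_metric)
qed

end

theorem theorem1p17:
  fixes d :: nat
    and \<phi> :: "real^'m \<Rightarrow> real^'m"
    and \<epsilon> :: real
    and \<tau>\<^sub>0 :: "real \<times> (real^'n) \<Rightarrow> real^'m"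
    and \<rho> :: "nat \<Rightarrow> real"
    and d\<^sub>0 :: "(real^'m) metric"
    and Z :: "'z metric"
    and \<iota> :: "real^'m \<Rightarrow> 'z"
    and \<zeta> :: "'z \<Rightarrow> 'z"
  assumes "odd d" and "d > 1"
    and "CARD('m) = d + 1" and "CARD('n) = d - 1"
    and "diffeomorphism_of (sphere 0 1) \<phi>"
    and "all_orbits_dense (sphere 0 1) \<phi>"
    and "\<epsilon> > 0"
    and "continuous_on ({-\<epsilon>..1 + \<epsilon>} \<times> cball 0 1) \<tau>\<^sub>0"
    and "inj_on \<tau>\<^sub>0 ({-\<epsilon>..1 + \<epsilon>} \<times> cball 0 1)"
    and "\<tau>\<^sub>0 ` ({-\<epsilon>..1 + \<epsilon>} \<times> cball 0 1) \<subseteq> sphere 0 1"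
    and "\<And>s x. \<bar>s\<bar> \<le> \<epsilon> \<Longrightarrow> x \<in> cball 0 1 \<Longrightarrow> \<tau>\<^sub>0 (s + 1, x) = \<phi> (\<tau>\<^sub>0 (s, x))"
    and "\<And>k :: int. k \<noteq> 0 \<Longrightarrow>
           iter (sphere 0 1) \<phi> k ` (\<tau>\<^sub>0 ` ({0..<1} \<times> {0})) \<inter> \<tau>\<^sub>0 ` ({0..<1} \<times> {0}) = {}"
    and "\<rho> 1 < 1"
    and "\<And>n. n \<ge> 1 \<Longrightarrow> \<rho> (Suc n) < \<rho> n"
    and "\<And>n. n \<ge> 1 \<Longrightarrow> \<rho> n > 0"
    and "\<And>n. n \<ge> 1 \<Longrightarrow> 2 * \<rho> n \<le> 1"
    and "\<And>n. n \<ge> 1 \<Longrightarrow>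
           inj_on (tau \<phi> \<tau>\<^sub>0) ({- real n - 2..real n + 2} \<times> cball 0 (2 * \<rho> n))"
    and "mspace d\<^sub>0 = sphere 0 1"
    and "mtopology_of d\<^sub>0 = top_of_set (sphere 0 1)"
    and "is_completion (sphere 0 1 - L_inf \<phi> \<tau>\<^sub>0) (dist_inf \<phi> \<tau>\<^sub>0 \<rho> d\<^sub>0) Z \<iota>"
    and "homeomorphic_map (mtopology_of Z) (mtopology_of Z) \<zeta>"
    and "\<And>x. x \<in> sphere 0 1 - L_inf \<phi> \<tau>\<^sub>0 \<Longrightarrow> \<zeta> (\<iota> x) = \<iota> (\<phi> x)"
  shows "minimal_map (mtopology_of Z) \<zeta>"
proof -
  let ?S = "sphere 0 1 :: (real^'m) set" and ?M = "sphere 0 1 - L_inf \<phi> \<tau>\<^sub>0"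
  note homeo = diffeomorphism_of_imp_homeo[OF \<open>diffeomorphism_of ?S \<phi>\<close>]
  interpret flow_tube \<phi> \<epsilon> \<tau>\<^sub>0
    by unfold_locales (fact homeo \<open>0 < \<epsilon>\<close> assms(8,10,11))+
  have dim: "CARD('m) = CARD('n) + 2"
    using assms(2-4) by simp
  have tube: "blown_up_tube \<phi> \<epsilon> \<tau>\<^sub>0 \<rho> n" if "1 \<le> n" for n
    by unfold_locales (use that dim assms(15-17) in auto)
  show ?thesis
  proof (rule minimal_map_if_continuous_dense_embedding)
    show "compact ?S" "continuous_on ?S \<phi>"
      using homeo by auto
    show "\<phi> ` ?S \<subseteq> ?S"
      using homeo(1) by (simp add: bij_betw_def)
    show "\<exists>n. dist ((\<phi> ^^ n) x) y < e" if "x \<in> ?S" "y \<in> ?S" "0 < e" for x y e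
      using forward_orbit_dense[OF _ homeo \<open>all_orbits_dense ?S \<phi>\<close> that] by simp
    show "\<phi> ` ?M \<subseteq> ?M"
      using L_inf_backward_invariant \<open>\<phi> ` ?S \<subseteq> ?S\<close> by blast
    show "continuous_map (top_of_set ?M) (mtopology_of Z) \<iota>"
      using tube assms(19,20) by (rule continuous_map_completion_embedding)
    show "mtopology_of Z closure_of (\<iota> ` ?M) = mspace Z"
      using assms(20) by (simp add: is_completion_def)
    show "continuous_map (mtopology_of Z) (mtopology_of Z) \<zeta>"
      using assms(21) by (rule homeomorphic_imp_continuous_map)
    show "\<And>x. x \<in> ?M \<Longrightarrow> \<zeta> (\<iota> x) = \<iota> (\<phi> x)"
      by (fact assms(22))
  qed blast
qed

end
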